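(* Let $H$ be a commutative ring with identity and $S\subseteq \mathrm{reg}(H)$ a multiplicatively closed subset of $H$. The following are equivalent: (1) The ring $H$ satisfies Property A. (2) For every ideal $A$ of $H$, $A$ is an $S$-$r$-ideal of the ring $H$ if and only if $A[x]$ is an $S$-$r$-ideal of the polynomial ring $H[x]$.
   Context: For an element $w$ of a ring $R$, $\mathrm{Ann}(w)=\{y\in R: yw=0\}$; $w$ is regular if $\mathrm{Ann}(w)=0$ and a zero divisor otherwise; $\mathrm{reg}(R)$ and $\mathrm{zd}(R)$ are the sets of regular elements and zero divisors of $R$. $H$ satisfies Property A if every finitely generated ideal $B$ of $H$ with $B\subseteq\mathrm{zd}(H)$ has non-zero annihilator. For an ideal $A$ of $H$, $A[x]$ is the ideal of $H[x]$ consisting of polynomials all of whose coefficients lie in $A$. A multiplicatively closed subset of a ring is a subset containing $1$ and closed under products; $S\subseteq H$ is viewed as a multiplicatively closed subset of $H[x]$ (constant polynomials). An ideal $A$ of a ring $R$ is an $S$-$r$-ideal if $A\cap S=\varnothing$ and there exists $s\in S$ such that for all $w,z\in R$, if $wz\in A$ and $\mathrm{Ann}_R(w)=0$, then $sz\in A$. *)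

theory Defs
  imports "HOL-Algebra.UnivPoly"
begin

definition Ann :: "('a, 'm) ring_scheme \<Rightarrow> 'a \<Rightarrow> 'a set" where
  "Ann R w = {y \<in> carrier R. y \<otimes>\<^bsub>R\<^esub> w = \<zero>\<^bsub>R\<^esub>}"

definition reg :: "('a, 'm) ring_scheme \<Rightarrow> 'a set" where
  "reg R = {w \<in> carrier R. Ann R w = {\<zero>\<^bsub>R\<^esub>}}"

definition zd :: "('a, 'm) ring_scheme \<Rightarrow> 'a set" where
  "zd R = {w \<in> carrier R. Ann R w \<noteq> {\<zero>\<^bsub>R\<^esub>}}"

definition Ann_set :: "('a, 'm) ring_scheme \<Rightarrow> 'a set \<Rightarrow> 'a set" where
  "Ann_set R B = {y \<in> carrier R. \<forall>b\<in>B. y \<otimes>\<^bsub>R\<^esub> b = \<zero>\<^bsub>R\<^esub>}"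

definition fg_ideal :: "('a, 'm) ring_scheme \<Rightarrow> 'a set \<Rightarrow> bool" where
  "fg_ideal R B \<longleftrightarrow> (\<exists>F. finite F \<and> F \<subseteq> carrier R \<and> B = Idl\<^bsub>R\<^esub> F)"

definition property_A :: "('a, 'm) ring_scheme \<Rightarrow> bool" where
  "property_A R \<longleftrightarrow>
     (\<forall>B. fg_ideal R B \<and> B \<subseteq> zd R \<longrightarrow> Ann_set R B \<noteq> {\<zero>\<^bsub>R\<^esub>})"

definition S_r_ideal :: "('a, 'm) ring_scheme \<Rightarrow> 'a set \<Rightarrow> 'a set \<Rightarrow> bool" where
  "S_r_ideal R S A \<longleftrightarrow>
     ideal A R \<and> A \<inter> S = {} \<and>
     (\<exists>s\<in>S. \<forall>w\<in>carrier R. \<forall>z\<in>carrier R.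
        w \<otimes>\<^bsub>R\<^esub> z \<in> A \<and> Ann R w = {\<zero>\<^bsub>R\<^esub>} \<longrightarrow> s \<otimes>\<^bsub>R\<^esub> z \<in> A)"

definition poly_ideal :: "('a, 'm) ring_scheme \<Rightarrow> 'a set \<Rightarrow> (nat \<Rightarrow> 'a) set" where
  "poly_ideal R A = {p \<in> carrier (UP R). \<forall>n. coeff (UP R) p n \<in> A}"

definition const_polys :: "('a, 'm) ring_scheme \<Rightarrow> 'a set \<Rightarrow> (nat \<Rightarrow> 'a) set" where
  "const_polys R S = (\<lambda>s. monom (UP R) s 0) ` S"

end

theory Submission
  imports Defs
begin

text \<open>
  Both sides of the equivalence are governed by McCoy's theorem, used relative to an ideal \<open>I\<close> of
  \<open>H\<close>: if \<open>f g \<in> I[x]\<close> and \<open>g \<notin> I[x]\<close>, then a single scalar \<open>c \<notin> I\<close> satisfies \<open>c f \<in> I[x]\<close>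
  (lemma \<open>McCoy_modulo_ideal\<close>). This converts statements about regular polynomials into
  statements about the finitely many coefficients of a polynomial, the setting of Property A.
  The second tool is the saturation of \<open>A\<close>, that is the contraction to \<open>H\<close> of the extension of \<open>A\<close>
  to the total ring of fractions; regular elements of \<open>H\<close> stay cancellable modulo it.

  Suppose Property A, and let \<open>A\<close> be an \<open>S\<close>-\<open>r\<close>-ideal with witness \<open>s\<close>. The defining condition
  says that \<open>s\<close> multiplies the saturation of \<open>A\<close> into \<open>A\<close>. A regular polynomial \<open>f\<close> has
  a content ideal with zero annihilator, so by Property A that ideal contains a regular element
  \<open>b\<close>. If \<open>f z \<in> A[x]\<close> while some coefficient of \<open>z\<close> were outside the saturation, the
  relative McCoy theorem would give \<open>c\<close> outside the saturation that multiplies the content of \<open>f\<close>,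
  in particular \<open>b\<close>, into the saturation; cancelling \<open>b\<close> is a contradiction. Hence \<open>s z \<in> A[x]\<close>.
  That \<open>A\<close> inherits the property from \<open>A[x]\<close> is seen on constant polynomials, since regular
  elements of \<open>H\<close> remain regular in \<open>H[x]\<close>.

  Conversely, let \<open>B\<close> be a finitely generated ideal of zero divisors with zero annihilator, and
  let \<open>A\<close> be its saturation. It contains no regular element, hence is disjoint from \<open>S\<close>, and it is
  an \<open>S\<close>-\<open>r\<close>-ideal with witness \<open>1\<close>. The polynomial \<open>f\<close> whose coefficients are the generators
  of \<open>B\<close> lies in \<open>A[x]\<close> and is regular by McCoy's theorem modulo \<open>0\<close>. So if \<open>A[x]\<close> were an
  \<open>S\<close>-\<open>r\<close>-ideal, then \<open>f 1 \<in> A[x]\<close> would force some \<open>s \<in> S\<close> into \<open>A\<close>, which is impossible.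
\<close>

section \<open>Ideals of a commutative ring\<close>

lemma (in cring) ideal_of_closure:
  assumes "I \<subseteq> carrier R" "\<zero> \<in> I"
    and add: "\<And>a b. a \<in> I \<Longrightarrow> b \<in> I \<Longrightarrow> a \<oplus> b \<in> I"
    and mult: "\<And>x a. x \<in> carrier R \<Longrightarrow> a \<in> I \<Longrightarrow> x \<otimes> a \<in> I"
  shows "ideal I R"
proof (rule idealI)
  show "ring R" by (rule ring_axioms)
  show "subgroup I (add_monoid R)"
  proof (rule add.subgroupI)
    show "I \<subseteq> carrier R" "I \<noteq> {}" using assms by auto
    show "a \<oplus> b \<in> I" if "a \<in> I" "b \<in> I" for a b by (rule add[OF that])
    show "\<ominus> a \<in> I" if "a \<in> I" for a
      using mult[of "\<ominus> \<one>" a] that assms(1) by (auto simp: l_minus)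
  qed
  show "x \<otimes> a \<in> I" if "a \<in> I" "x \<in> carrier R" for a x by (rule mult[OF that(2,1)])
  show "a \<otimes> x \<in> I" if "a \<in> I" "x \<in> carrier R" for a x
    using mult[OF that(2,1)] that assms(1) m_comm[of a x] by auto
qed

lemma (in ring) ideal_finsum_closed:
  assumes I: "ideal I R" and "finite K" "\<And>i. i \<in> K \<Longrightarrow> h i \<in> I"
  shows "(\<Oplus>i\<in>K. h i) \<in> I"
proof -
  interpret I: ideal I R by (rule I)
  show ?thesis using assms(2,3)
    by (induction K rule: finite_induct) (auto simp: Pi_def I.Icarr)
qed

lemma (in ring) remaining_summand_in_ideal:
  assumes I: "ideal I R" and K: "finite K" "k \<in> K" and h: "h \<in> K \<rightarrow> carrier R"
    and total: "(\<Oplus>i\<in>K. h i) \<in> I" and rest: "\<And>i. i \<in> K \<Longrightarrow> i \<noteq> k \<Longrightarrow> h i \<in> I"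
  shows "h k \<in> I"
proof -
  interpret I: ideal I R by (rule I)
  let ?t = "\<Oplus>i\<in>K - {k}. h i"
  have t: "?t \<in> I" using K rest by (intro ideal_finsum_closed[OF I]) auto
  have hk: "h k \<in> carrier R" using K h by auto
  have "(\<Oplus>i\<in>insert k (K - {k}). h i) = h k \<oplus> ?t"
    using K h by (intro finsum_insert) auto
  then have sum: "(\<Oplus>i\<in>K. h i) = h k \<oplus> ?t" using K by (simp add: insert_absorb)
  have "(\<Oplus>i\<in>K. h i) \<oplus> (\<ominus> ?t) \<in> I" by (intro I.a_closed total I.a_inv_closed t)
  moreover have "(\<Oplus>i\<in>K. h i) \<oplus> (\<ominus> ?t) = h k"
    using hk I.Icarr[OF t] by (simp add: sum a_assoc r_neg)
  ultimately show ?thesis by simp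
qed

text \<open>
  The preimage of an ideal under multiplication by a fixed element is an ideal. Hence whether an
  element multiplies a generated ideal into \<open>I\<close> can be tested on the generators.
\<close>

lemma (in cring) mult_genideal_subset_ideal:
  assumes I: "ideal I R" and c: "c \<in> carrier R" and F: "F \<subseteq> carrier R"
    and gens: "\<And>a. a \<in> F \<Longrightarrow> c \<otimes> a \<in> I" and b: "b \<in> Idl F"
  shows "c \<otimes> b \<in> I"
proof -
  interpret I: ideal I R by (rule I)
  have "ideal {b \<in> carrier R. c \<otimes> b \<in> I} R"
  proof (rule ideal_of_closure)
    show "x \<otimes> a \<in> {b \<in> carrier R. c \<otimes> b \<in> I}"
      if "x \<in> carrier R" "a \<in> {b \<in> carrier R. c \<otimes> b \<in> I}" for x a
      using that c I.I_l_closed[of "c \<otimes> a" x] by (simp add: m_lcomm)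
  qed (use c in \<open>auto simp: r_distr\<close>)
  from genideal_minimal[OF this] show ?thesis using F gens b by blast
qed

section \<open>Saturation by regular elements\<close>

lemma (in cring) reg_mult_eq_zeroD:
  assumes "w \<in> reg R" "z \<in> carrier R" "w \<otimes> z = \<zero>"
  shows "z = \<zero>"
proof -
  have w: "w \<in> carrier R" "Ann R w = {\<zero>}" using assms(1) by (auto simp: reg_def)
  have "z \<in> Ann R w" using w(1) assms(2,3) by (simp add: Ann_def m_comm)
  with w show ?thesis by simp
qed

lemma (in cring) regI:
  assumes "w \<in> carrier R" "\<And>z. z \<in> carrier R \<Longrightarrow> z \<otimes> w = \<zero> \<Longrightarrow> z = \<zero>"
  shows "w \<in> reg R"
  using assms by (auto simp: reg_def Ann_def)

lemma (in cring) one_reg: "\<one> \<in> reg R"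
  by (rule regI) auto

lemma (in cring) reg_mult_closed:
  assumes v: "v \<in> reg R" and w: "w \<in> reg R"
  shows "v \<otimes> w \<in> reg R"
proof (rule regI)
  have c: "v \<in> carrier R" "w \<in> carrier R" using v w by (auto simp: reg_def)
  then show "v \<otimes> w \<in> carrier R" by simp
  fix z assume z: "z \<in> carrier R" "z \<otimes> (v \<otimes> w) = \<zero>"
  then have "v \<otimes> (w \<otimes> z) = \<zero>" using c by (simp add: m_ac)
  then have "w \<otimes> z = \<zero>" using reg_mult_eq_zeroD[OF v] c z by simp
  then show "z = \<zero>" using reg_mult_eq_zeroD[OF w] z by simp
qed

text \<open>
  This is the preimage in \<open>R\<close> of the ideal that \<open>A\<close> generates in the total ring of fractions. The
  description inside \<open>R\<close> avoids constructing that ring.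
\<close>

definition saturation :: "('a, 'm) ring_scheme \<Rightarrow> 'a set \<Rightarrow> 'a set" where
  "saturation R A = {z \<in> carrier R. \<exists>w\<in>reg R. w \<otimes>\<^bsub>R\<^esub> z \<in> A}"

lemma (in cring) subset_saturation:
  assumes "A \<subseteq> carrier R"
  shows "A \<subseteq> saturation R A"
  using assms one_reg by (force simp: saturation_def)

text \<open>Closure under addition uses the product of two regular elements as common denominator.\<close>

lemma (in cring) saturation_ideal:
  assumes A: "ideal A R"
  shows "ideal (saturation R A) R"
proof (rule ideal_of_closure)
  interpret A: ideal A R by (rule A)
  show "saturation R A \<subseteq> carrier R" by (auto simp: saturation_def)
  show "\<zero> \<in> saturation R A" using subset_saturation[OF A.a_subset] by auto
  show "a \<oplus> b \<in> saturation R A" if ab: "a \<in> saturation R A" "b \<in> saturation R A" for a b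
  proof -
    from ab obtain v w where v: "v \<in> reg R" "v \<otimes> a \<in> A" and w: "w \<in> reg R" "w \<otimes> b \<in> A"
      and c: "a \<in> carrier R" "b \<in> carrier R" by (auto simp: saturation_def)
    have vw: "v \<in> carrier R" "w \<in> carrier R" using v w by (auto simp: reg_def)
    have "(v \<otimes> w) \<otimes> (a \<oplus> b) = w \<otimes> (v \<otimes> a) \<oplus> v \<otimes> (w \<otimes> b)"
      using vw c by (simp add: r_distr m_ac)
    also have "\<dots> \<in> A" by (rule A.a_closed[OF A.I_l_closed[OF v(2) vw(2)] A.I_l_closed[OF w(2) vw(1)]])
    finally show ?thesis using reg_mult_closed[OF v(1) w(1)] c by (auto simp: saturation_def)
  qed
  show "x \<otimes> a \<in> saturation R A" if xa: "x \<in> carrier R" "a \<in> saturation R A" for x a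
  proof -
    from xa obtain v where v: "v \<in> reg R" "v \<otimes> a \<in> A" and c: "a \<in> carrier R"
      by (auto simp: saturation_def)
    have vc: "v \<in> carrier R" using v by (auto simp: reg_def)
    have "v \<otimes> (x \<otimes> a) \<in> A" using A.I_l_closed[OF v(2) xa(1)] vc c xa(1) by (simp add: m_lcomm)
    then show ?thesis using v c xa(1) by (auto simp: saturation_def)
  qed
qed

lemma (in cring) saturation_cancel_reg:
  assumes b: "b \<in> reg R" and z: "z \<in> carrier R" and bz: "b \<otimes> z \<in> saturation R A"
  shows "z \<in> saturation R A"
proof -
  from bz obtain w where w: "w \<in> reg R" "w \<otimes> (b \<otimes> z) \<in> A" by (auto simp: saturation_def)
  have "(w \<otimes> b) \<otimes> z \<in> A" using w b z by (auto simp: m_assoc reg_def)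
  then show ?thesis using reg_mult_closed[OF w(1) b] z by (auto simp: saturation_def)
qed

lemma (in cring) saturation_disjoint_reg:
  assumes "A \<subseteq> zd R"
  shows "saturation R A \<inter> reg R = {}"
proof -
  have False if "z \<in> reg R" "w \<in> reg R" "w \<otimes> z \<in> A" for w z
    using reg_mult_closed[OF that(2,1)] that(3) assms by (auto simp: reg_def zd_def)
  then show ?thesis by (auto simp: saturation_def)
qed

section \<open>McCoy's theorem modulo an ideal\<close>

lemma poly_idealI:
  assumes "p \<in> carrier (UP R)" "\<And>n. coeff (UP R) p n \<in> A"
  shows "p \<in> poly_ideal R A"
  using assms by (simp add: poly_ideal_def)

lemma poly_idealD:
  assumes "p \<in> poly_ideal R A"
  shows "p \<in> carrier (UP R)" "coeff (UP R) p n \<in> A"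
  using assms by (auto simp: poly_ideal_def)

context UP_cring
begin

lemma monom_0_in_poly_ideal_iff:
  assumes "ideal A R" "a \<in> carrier R"
  shows "monom P a 0 \<in> poly_ideal R A \<longleftrightarrow> a \<in> A"
proof -
  interpret A: ideal A R by (rule assms(1))
  show ?thesis using assms(2) by (auto simp: poly_ideal_def P_def[symmetric] split: if_splits)
qed

lemma coeff_monom_0_mult:
  assumes "a \<in> carrier R" "p \<in> carrier P"
  shows "coeff P (monom P a 0 \<otimes>\<^bsub>P\<^esub> p) n = a \<otimes> coeff P p n"
  using assms by (simp add: monom_mult_is_smult del: coeff_mult)

lemma poly_ideal_ideal:
  assumes A: "ideal A R"
  shows "ideal (poly_ideal R A) P"
proof (rule P.ideal_of_closure)
  interpret A: ideal A R by (rule A)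
  show "poly_ideal R A \<subseteq> carrier P" by (auto simp: poly_ideal_def P_def)
  show "\<zero>\<^bsub>P\<^esub> \<in> poly_ideal R A" by (auto simp: poly_ideal_def P_def[symmetric])
  show "p \<oplus>\<^bsub>P\<^esub> q \<in> poly_ideal R A" if "p \<in> poly_ideal R A" "q \<in> poly_ideal R A" for p q
    using that by (auto simp: poly_ideal_def P_def[symmetric])
  show "p \<otimes>\<^bsub>P\<^esub> q \<in> poly_ideal R A" if "p \<in> carrier P" "q \<in> poly_ideal R A" for p q
    using that
    by (auto simp: poly_ideal_def P_def[symmetric] intro!: R.ideal_finsum_closed[OF A] A.I_l_closed)
qed

text \<open>
  The usual proof takes \<open>g\<close> of minimal degree. Here the induction is on a bound \<open>m\<close> beyond which
  the coefficients of \<open>g\<close> lie in \<open>I\<close>, that is on the degree modulo \<open>I\<close>. If some \<open>f\<^sub>i g\<close> is not in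
  \<open>I[x]\<close>, take \<open>i\<close> largest. Modulo \<open>I\<close>, the coefficient of \<open>f g\<close> that pairs \<open>f\<^sub>i\<close> with the
  top coefficient of \<open>g\<close> has no other term, so the top coefficient of \<open>f\<^sub>i g\<close> lies in \<open>I\<close>, and
  \<open>f\<^sub>i g\<close> satisfies the hypotheses on \<open>g\<close> with a smaller bound. If all \<open>f\<^sub>i g\<close> are in
  \<open>I[x]\<close>, any coefficient of \<open>g\<close> outside \<open>I\<close> serves as \<open>c\<close>.
\<close>

lemma McCoy_modulo_ideal:
  assumes I: "ideal I R" and f: "f \<in> carrier P"
    and g: "g \<in> carrier P" "g \<notin> poly_ideal R I"
    and fg: "f \<otimes>\<^bsub>P\<^esub> g \<in> poly_ideal R I"
  obtains c where "c \<in> carrier R" "c \<notin> I" "\<And>i. c \<otimes> coeff P f i \<in> I"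
proof -
  interpret I: ideal I R by (rule I)
  have bounded: "\<exists>c\<in>carrier R. c \<notin> I \<and> (\<forall>i. c \<otimes> coeff P f i \<in> I)"
    if "g \<in> carrier P" "g \<notin> poly_ideal R I" "f \<otimes>\<^bsub>P\<^esub> g \<in> poly_ideal R I"
      "\<forall>k\<ge>m. coeff P g k \<in> I" for m g
    using that
  proof (induction m arbitrary: g)
    case 0
    then show ?case by (auto simp: poly_ideal_def P_def[symmetric])
  next
    case (Suc m)
    note gc = Suc.prems(1)
    let ?bad = "\<lambda>i. \<exists>k. coeff P f i \<otimes> coeff P g k \<notin> I"
    show ?case
    proof (cases "\<exists>i. ?bad i")
      case False
      obtain k where k: "coeff P g k \<notin> I"
        using Suc.prems(1,2) by (auto simp: poly_ideal_def P_def[symmetric])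
      have "coeff P g k \<otimes> coeff P f i \<in> I" for i
        using False R.m_comm[of "coeff P g k" "coeff P f i"] gc f by auto
      then show ?thesis using k gc by auto
    next
      case True
      have le: "i \<le> deg R f" if "?bad i" for i
      proof (rule ccontr)
        assume "\<not> i \<le> deg R f"
        then have "coeff P f i = \<zero>" using deg_aboveD f by simp
        then show False using that gc by simp
      qed
      define i where "i = (GREATEST i. ?bad i)"
      have bad_i: "?bad i" unfolding i_def
        by (rule GreatestI_ex_nat[where P = ?bad, OF True le])
      have max_i: "\<not> ?bad j" if "i < j" for j
      proof
        assume "?bad j"
        then have "j \<le> i" unfolding i_def by (rule Greatest_le_nat[where P = ?bad]) (rule le)
        with that show False by simp
      qed
      have ic: "coeff P f i \<in> carrier R" using f by simp
      let ?h = "coeff P f i \<odot>\<^bsub>P\<^esub> g"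
      have top: "coeff P f i \<otimes> coeff P g m \<in> I"
      proof -
        have "coeff P f i \<otimes> coeff P g (i + m - i) \<in> I"
        proof (rule R.remaining_summand_in_ideal[OF I, where K = "{..i + m}"
              and h = "\<lambda>j. coeff P f j \<otimes> coeff P g (i + m - j)"])
          show "(\<Oplus>j\<in>{..i + m}. coeff P f j \<otimes> coeff P g (i + m - j)) \<in> I"
            using poly_idealD(2)[OF Suc.prems(3), of "i + m"] f gc
            by (simp add: P_def[symmetric])
          show "coeff P f j \<otimes> coeff P g (i + m - j) \<in> I" if "j \<in> {..i + m}" "j \<noteq> i" for j
          proof (cases "j < i")
            case True
            then show ?thesis using Suc.prems(4) f by (intro I.I_l_closed) auto
          next
            case False
            then show ?thesis using max_i[of j] that by auto
          qed
        qed (use f gc in auto)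
        then show ?thesis by simp
      qed
      show ?thesis
      proof (rule Suc.IH)
        show "?h \<in> carrier P" using ic gc by simp
        show "?h \<notin> poly_ideal R I"
          using bad_i ic gc poly_idealD(2)[of ?h R I] by (auto simp: P_def[symmetric])
        have "f \<otimes>\<^bsub>P\<^esub> ?h = coeff P f i \<odot>\<^bsub>P\<^esub> (f \<otimes>\<^bsub>P\<^esub> g)"
          using ic gc f
          by (metis P.m_comm UP_smult_assoc2 UP_smult_closed)
        also have "\<dots> \<in> poly_ideal R I"
          using poly_idealD[OF Suc.prems(3)] ic f gc
          by (intro poly_idealI)
            (auto simp: P_def[symmetric] simp del: coeff_mult intro: I.I_l_closed)
        finally show "f \<otimes>\<^bsub>P\<^esub> ?h \<in> poly_ideal R I" .
        show "\<forall>k\<ge>m. coeff P ?h k \<in> I"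
        proof (intro allI impI)
          fix k assume "m \<le> k"
          then show "coeff P ?h k \<in> I"
            using top Suc.prems(4) ic gc by (cases "k = m") (auto intro: I.I_l_closed)
        qed
      qed
    qed
  qed
  have "\<forall>k\<ge>Suc (deg R g). coeff P g k \<in> I" using g(1) by (auto simp: deg_aboveD)
  from bounded[OF g fg this] that show thesis by blast
qed

section \<open>Regular polynomials and their coefficients\<close>

lemma finite_coeffs:
  assumes "p \<in> carrier P"
  shows "finite (range (coeff P p))"
proof (rule finite_subset)
  show "range (coeff P p) \<subseteq> insert \<zero> (coeff P p ` {..deg R p})"
  proof (rule image_subsetI)
    fix n
    show "coeff P p n \<in> insert \<zero> (coeff P p ` {..deg R p})"
      using deg_aboveD[OF _ assms, of n] by (cases "n \<le> deg R p") auto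
  qed
qed simp

lemma ex_poly_with_coeffs:
  assumes "finite F" "F \<subseteq> carrier R"
  obtains f where "f \<in> carrier P" "F \<subseteq> range (coeff P f)" "range (coeff P f) \<subseteq> insert \<zero> F"
proof -
  obtain xs where xs: "set xs = F" using finite_list[OF assms(1)] by blast
  define f where "f n = (if n < length xs then xs ! n else \<zero>)" for n
  have "bound \<zero> (length xs) f" by (auto simp: f_def)
  moreover have "f n \<in> carrier R" for n using assms(2) xs by (auto simp: f_def)
  ultimately have f: "f \<in> up R" by auto
  then have cf: "f \<in> carrier P" "coeff P f = f" by (auto simp: P_def UP_def)
  have "F \<subseteq> range f"
  proof
    fix a assume "a \<in> F"
    then obtain n where "n < length xs" "xs ! n = a" using xs by (auto simp: in_set_conv_nth)
    then have "f n = a" by (simp add: f_def)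
    then show "a \<in> range f" by blast
  qed
  moreover have "range f \<subseteq> insert \<zero> F" using xs by (auto simp: f_def)
  ultimately show thesis using that cf by simp
qed

text \<open>McCoy's theorem in its classical form, modulo the zero ideal.\<close>

lemma reg_poly_if_coeffs_no_annihilator:
  assumes f: "f \<in> carrier P"
    and ann: "\<And>c. c \<in> carrier R \<Longrightarrow> (\<And>i. c \<otimes> coeff P f i = \<zero>) \<Longrightarrow> c = \<zero>"
  shows "f \<in> reg P"
proof (rule P.regI[OF f])
  fix g assume g: "g \<in> carrier P" "g \<otimes>\<^bsub>P\<^esub> f = \<zero>\<^bsub>P\<^esub>"
  have fg: "f \<otimes>\<^bsub>P\<^esub> g \<in> poly_ideal R {\<zero>}"
    using g f by (simp add: P.m_comm poly_ideal_def P_def[symmetric] del: coeff_mult)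
  show "g = \<zero>\<^bsub>P\<^esub>"
  proof (cases "g \<in> poly_ideal R {\<zero>}")
    case True
    then show ?thesis using g(1) by (intro up_eqI) (auto simp: poly_ideal_def P_def[symmetric])
  next
    case False
    from McCoy_modulo_ideal[OF R.zeroideal f g(1) False fg] ann show ?thesis by auto
  qed
qed

text \<open>
  A scalar annihilating the content ideal of \<open>f\<close> is a constant polynomial annihilating \<open>f\<close>, hence
  zero. By Property A the content ideal then cannot consist of zero divisors.
\<close>

lemma property_A_content_contains_reg:
  assumes "property_A R" and f: "f \<in> reg P"
  obtains b where "b \<in> reg R" "b \<in> Idl (range (coeff P f))"
proof -
  have fc: "f \<in> carrier P" using f by (simp add: reg_def)
  let ?F = "range (coeff P f)"
  have F: "?F \<subseteq> carrier R" "finite ?F" using fc finite_coeffs by auto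
  have "c = \<zero>" if c: "c \<in> Ann_set R (Idl ?F)" for c
  proof -
    have cc: "c \<in> carrier R" using c by (simp add: Ann_set_def)
    have cf: "c \<otimes> coeff P f i = \<zero>" for i
      using c R.genideal_self[OF F(1)] by (auto simp: Ann_set_def)
    have "f \<otimes>\<^bsub>P\<^esub> monom P c 0 = monom P c 0 \<otimes>\<^bsub>P\<^esub> f" using fc cc by (simp add: P.m_comm)
    also have "\<dots> = \<zero>\<^bsub>P\<^esub>"
      using fc cc cf by (intro up_eqI) (simp_all add: coeff_monom_0_mult del: coeff_mult)
    finally have "monom P c 0 = \<zero>\<^bsub>P\<^esub>" using P.reg_mult_eq_zeroD[OF f] cc by simp
    then have "coeff P (monom P c 0) 0 = coeff P \<zero>\<^bsub>P\<^esub> 0" by simp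
    then show ?thesis using cc by simp
  qed
  moreover have "\<zero> \<in> Ann_set R (Idl ?F)"
    using ideal.Icarr[OF R.genideal_ideal[OF F(1)]] by (auto simp: Ann_set_def)
  ultimately have "Ann_set R (Idl ?F) = {\<zero>}" by blast
  moreover have "fg_ideal R (Idl ?F)" using F by (auto simp: fg_ideal_def)
  ultimately have "\<not> Idl ?F \<subseteq> zd R" using assms(1) by (auto simp: property_A_def)
  then obtain b where b: "b \<in> Idl ?F" "b \<notin> zd R" by blast
  have "b \<in> carrier R" using ideal.Icarr[OF R.genideal_ideal[OF F(1)] b(1)] .
  with b that show thesis by (auto simp: zd_def reg_def)
qed

lemma monom_0_reg:
  assumes w: "w \<in> reg R"
  shows "monom P w 0 \<in> reg P"
proof (rule reg_poly_if_coeffs_no_annihilator)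
  have wc: "w \<in> carrier R" using w by (simp add: reg_def)
  then show "monom P w 0 \<in> carrier P" by simp
  fix c assume c: "c \<in> carrier R" and *: "\<And>i. c \<otimes> coeff P (monom P w 0) i = \<zero>"
  have "w \<otimes> c = \<zero>" using *[of 0] wc c by (simp add: R.m_comm)
  then show "c = \<zero>" by (rule R.reg_mult_eq_zeroD[OF w c])
qed

end

section \<open>Transfer of \<open>S\<close>-\<open>r\<close>-ideals to polynomials\<close>

lemma S_r_ideal_iff_reg:
  "S_r_ideal R S A \<longleftrightarrow> ideal A R \<and> A \<inter> S = {} \<and>
     (\<exists>s\<in>S. \<forall>w\<in>reg R. \<forall>z\<in>carrier R. w \<otimes>\<^bsub>R\<^esub> z \<in> A \<longrightarrow> s \<otimes>\<^bsub>R\<^esub> z \<in> A)"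
  unfolding S_r_ideal_def reg_def by (simp add: Ball_def Bex_def) blast

context UP_cring
begin

lemma poly_ideal_disjoint_const_polys_iff:
  assumes "ideal A R" "S \<subseteq> carrier R"
  shows "poly_ideal R A \<inter> const_polys R S = {} \<longleftrightarrow> A \<inter> S = {}"
proof -
  have "monom P a 0 \<in> poly_ideal R A \<longleftrightarrow> a \<in> A" if "a \<in> S" for a
    using monom_0_in_poly_ideal_iff[OF assms(1)] assms(2) that by blast
  then show ?thesis unfolding const_polys_def P_def[symmetric] by blast
qed

lemma S_r_ideal_if_S_r_poly_ideal:
  assumes A: "ideal A R" and S: "S \<subseteq> carrier R"
    and poly: "S_r_ideal P (const_polys R S) (poly_ideal R A)"
  shows "S_r_ideal R S A"
proof -
  from poly obtain s where s: "s \<in> S" and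
    witness: "\<And>w z. w \<in> reg P \<Longrightarrow> z \<in> carrier P \<Longrightarrow> w \<otimes>\<^bsub>P\<^esub> z \<in> poly_ideal R A
      \<Longrightarrow> monom P s 0 \<otimes>\<^bsub>P\<^esub> z \<in> poly_ideal R A"
    by (auto simp: S_r_ideal_iff_reg const_polys_def P_def[symmetric])
  have "s \<otimes> z \<in> A" if w: "w \<in> reg R" and z: "z \<in> carrier R" and wz: "w \<otimes> z \<in> A" for w z
  proof -
    have const_mult: "monom P a 0 \<otimes>\<^bsub>P\<^esub> monom P z 0 = monom P (a \<otimes> z) 0"
      if "a \<in> carrier R" for a
      using monom_mult[OF that z, of 0 0] by simp
    have wc: "w \<in> carrier R" using w by (simp add: reg_def)
    have "monom P w 0 \<otimes>\<^bsub>P\<^esub> monom P z 0 \<in> poly_ideal R A"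
      using wc z wz by (simp add: const_mult monom_0_in_poly_ideal_iff[OF A])
    then have "monom P s 0 \<otimes>\<^bsub>P\<^esub> monom P z 0 \<in> poly_ideal R A"
      using witness[OF monom_0_reg[OF w]] z by simp
    moreover have "s \<in> carrier R" using s S by auto
    ultimately show ?thesis using z by (simp add: const_mult monom_0_in_poly_ideal_iff[OF A])
  qed
  then show ?thesis
    using A s poly poly_ideal_disjoint_const_polys_iff[OF A S] by (auto simp: S_r_ideal_iff_reg)
qed

text \<open>
  McCoy's theorem is applied modulo the saturation of \<open>A\<close> rather than modulo \<open>A\<close> itself, because
  only modulo the former can the regular element in the content of \<open>f\<close> be cancelled.
\<close>

lemma property_A_mult_in_saturation:
  assumes "property_A R" and A: "ideal A R"
    and f: "f \<in> reg P" and z: "z \<in> carrier P" and fz: "f \<otimes>\<^bsub>P\<^esub> z \<in> poly_ideal R A"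
  shows "z \<in> poly_ideal R (saturation R A)"
proof (rule ccontr)
  assume not_in: "z \<notin> poly_ideal R (saturation R A)"
  have fc: "f \<in> carrier P" using f by (simp add: reg_def)
  have sub: "A \<subseteq> saturation R A"
    using R.subset_saturation ideal.Icarr[OF A] by blast
  note sat = R.saturation_ideal[OF A]
  have "poly_ideal R A \<subseteq> poly_ideal R (saturation R A)"
    using sub by (auto simp: poly_ideal_def)
  then have "f \<otimes>\<^bsub>P\<^esub> z \<in> poly_ideal R (saturation R A)" using fz by blast
  then obtain c where c: "c \<in> carrier R" "c \<notin> saturation R A"
    and cf: "\<And>i. c \<otimes> coeff P f i \<in> saturation R A"
    using McCoy_modulo_ideal[OF sat fc z not_in] by blast
  obtain b where b: "b \<in> reg R" "b \<in> Idl (range (coeff P f))"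
    using property_A_content_contains_reg[OF assms(1) f] .
  have "c \<otimes> b \<in> saturation R A"
    using fc cf by (intro R.mult_genideal_subset_ideal[OF sat c(1) _ _ b(2)]) auto
  then have "b \<otimes> c \<in> saturation R A" using b(1) c(1) by (simp add: R.m_comm reg_def)
  then show False using R.saturation_cancel_reg[OF b(1) c(1)] c(2) by blast
qed

lemma property_A_S_r_poly_ideal:
  assumes "property_A R" and S: "S \<subseteq> carrier R" and SA: "S_r_ideal R S A"
  shows "S_r_ideal P (const_polys R S) (poly_ideal R A)"
proof -
  from SA obtain s where A: "ideal A R" and disj: "A \<inter> S = {}" and s: "s \<in> S" and
    witness: "\<And>w z. w \<in> reg R \<Longrightarrow> z \<in> carrier R \<Longrightarrow> w \<otimes> z \<in> A \<Longrightarrow> s \<otimes> z \<in> A"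
    by (auto simp: S_r_ideal_iff_reg)
  have sc: "s \<in> carrier R" using s S by auto
  have sat: "s \<otimes> z \<in> A" if "z \<in> saturation R A" for z
    using that witness by (auto simp: saturation_def)
  have "monom P s 0 \<otimes>\<^bsub>P\<^esub> z \<in> poly_ideal R A"
    if "f \<in> reg P" "z \<in> carrier P" "f \<otimes>\<^bsub>P\<^esub> z \<in> poly_ideal R A" for f z
  proof -
    note z = property_A_mult_in_saturation[OF assms(1) A that]
    show ?thesis
    proof (rule poly_idealI, fold P_def)
      show "monom P s 0 \<otimes>\<^bsub>P\<^esub> z \<in> carrier P" using sc that(2) by simp
      show "coeff P (monom P s 0 \<otimes>\<^bsub>P\<^esub> z) n \<in> A" for n
        using sat[OF poly_idealD(2)[OF z, of n]] coeff_monom_0_mult[OF sc that(2), of n]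
        by (simp add: P_def)
    qed
  qed
  moreover have "monom P s 0 \<in> const_polys R S"
    using s by (simp add: const_polys_def P_def)
  moreover have "poly_ideal R A \<inter> const_polys R S = {}"
    using disj poly_ideal_disjoint_const_polys_iff[OF A S] by simp
  ultimately show ?thesis using poly_ideal_ideal[OF A] unfolding S_r_ideal_iff_reg by blast
qed

text \<open>
  The saturation of a finitely generated ideal of zero divisors is the test ideal: it is always an
  \<open>S\<close>-\<open>r\<close>-ideal, but its polynomial extension contains a regular polynomial as soon as
  the given ideal has no non-zero annihilator.
\<close>

lemma property_A_if_S_r_poly_ideals:
  assumes one: "\<one> \<in> S" and S: "S \<subseteq> reg R"
    and transfer: "\<And>A. S_r_ideal R S A \<Longrightarrow> S_r_ideal P (const_polys R S) (poly_ideal R A)"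
  shows "property_A R"
  unfolding property_A_def
proof (intro allI impI notI)
  fix B assume "fg_ideal R B \<and> B \<subseteq> zd R" and ann: "Ann_set R B = {\<zero>}"
  then obtain F where F: "finite F" "F \<subseteq> carrier R" and B: "B = Idl F" and zd: "B \<subseteq> zd R"
    by (auto simp: fg_ideal_def)
  have Bid: "ideal B R" using R.genideal_ideal[OF F(2)] B by simp
  let ?A = "saturation R B"
  have A: "ideal ?A R" by (rule R.saturation_ideal[OF Bid])
  have disj: "?A \<inter> S = {}" using R.saturation_disjoint_reg[OF zd] S by blast
  have "S_r_ideal R S ?A"
    unfolding S_r_ideal_iff_reg
    using A disj one R.saturation_cancel_reg by (intro conjI bexI[of _ \<one>]) auto
  from transfer[OF this] obtain s where s: "s \<in> S" and
    witness: "\<And>w z. w \<in> reg P \<Longrightarrow> z \<in> carrier P \<Longrightarrow> w \<otimes>\<^bsub>P\<^esub> z \<in> poly_ideal R ?A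
      \<Longrightarrow> monom P s 0 \<otimes>\<^bsub>P\<^esub> z \<in> poly_ideal R ?A"
    by (auto simp: S_r_ideal_iff_reg const_polys_def P_def[symmetric])
  obtain f where f: "f \<in> carrier P" "F \<subseteq> range (coeff P f)" "range (coeff P f) \<subseteq> insert \<zero> F"
    using ex_poly_with_coeffs[OF F] .
  have "f \<in> reg P"
  proof (rule reg_poly_if_coeffs_no_annihilator[OF f(1)])
    fix c assume c: "c \<in> carrier R" "\<And>i. c \<otimes> coeff P f i = \<zero>"
    have gens: "c \<otimes> a \<in> {\<zero>}" if "a \<in> F" for a using c(2) f(2) that by auto
    have "c \<otimes> b \<in> {\<zero>}" if "b \<in> B" for b
      using R.mult_genideal_subset_ideal[OF R.zeroideal c(1) F(2) gens] that B by blast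
    then have "c \<in> Ann_set R B" using c(1) by (auto simp: Ann_set_def)
    then show "c = \<zero>" using ann by simp
  qed
  moreover have "f \<in> poly_ideal R ?A"
  proof (rule poly_idealI, fold P_def)
    show "f \<in> carrier P" by (rule f(1))
    have "insert \<zero> F \<subseteq> B"
      using R.genideal_self[OF F(2)] B additive_subgroup.zero_closed[OF ideal.axioms(1)[OF Bid]]
      by auto
    moreover have "B \<subseteq> ?A" using R.subset_saturation ideal.Icarr[OF Bid] by blast
    ultimately show "coeff P f n \<in> ?A" for n using f(3) by blast
  qed
  ultimately have "monom P s 0 \<otimes>\<^bsub>P\<^esub> \<one>\<^bsub>P\<^esub> \<in> poly_ideal R ?A" using witness f(1) by simp
  moreover have sc: "s \<in> carrier R" using s S by (auto simp: reg_def)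
  ultimately have "s \<in> ?A" using monom_0_in_poly_ideal_iff[OF A] by simp
  then show False using disj s by blast
qed

end

section \<open>Property A and \<open>S\<close>-\<open>r\<close>-ideals\<close>

theorem theorem4p1:
  fixes H :: "('a, 'm) ring_scheme" and S :: "'a set"
  assumes "cring H"
    and "submonoid S H"
    and "S \<subseteq> reg H"
  shows "property_A H \<longleftrightarrow>
    (\<forall>A. ideal A H \<longrightarrow>
       (S_r_ideal H S A \<longleftrightarrow> S_r_ideal (UP H) (const_polys H S) (poly_ideal H A)))"
proof -
  interpret UP_cring H "UP H"
    by (intro UP_cring.intro assms(1)) simp_all
  have S: "S \<subseteq> carrier H" using assms(3) by (auto simp: reg_def)
  show ?thesis
  proof
    assume "property_A H"
    then show "\<forall>A. ideal A H \<longrightarrow>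
        (S_r_ideal H S A \<longleftrightarrow> S_r_ideal (UP H) (const_polys H S) (poly_ideal H A))"
      using property_A_S_r_poly_ideal S_r_ideal_if_S_r_poly_ideal S by blast
  next
    assume transfer: "\<forall>A. ideal A H \<longrightarrow>
        (S_r_ideal H S A \<longleftrightarrow> S_r_ideal (UP H) (const_polys H S) (poly_ideal H A))"
    show "property_A H"
    proof (rule property_A_if_S_r_poly_ideals[OF submonoid.one_closed[OF assms(2)] assms(3)])
      fix A assume "S_r_ideal H S A"
      moreover from this have "ideal A H" by (simp add: S_r_ideal_def)
      ultimately show "S_r_ideal (UP H) (const_polys H S) (poly_ideal H A)"
        using transfer by blast
    qed
  qed
qed

end
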